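(* Let $k\ge3$, $n=2^k$, let $G_k$ be the ring graph on $n$ nodes, and let $p>1$. Let $\mathbf{X}$ be a set of feasible solutions of the LambdaPrime LP relaxation of $G_k$ such that for every $\lambda\in\left[\frac{8}{n^2},\frac12\right]$, $\mathbf{X}$ contains a feasible solution whose objective value at $\lambda$ is at most $p$ times the optimal LP value at $\lambda$. Then $$|\mathbf{X}|\ge B=\left\lceil \frac23\log_{\gamma(pM)}\frac n4\right\rceil=\Omega(\log n),$$ where $M=4\sqrt2/3$ and $\gamma(x)=\left(2x^2-1+2x\sqrt{x^2-1}\right)^2$.
   Context: The ring graph $G_k$ has nodes $\{1,\dots,n\}$ and edges $\{i,i+1\}$ for $i=1,\dots,n-1$ and $\{1,n\}$. The LambdaPrime LP relaxation of a graph $G=(V,E)$ with parameter $\lambda$ has variables $x_{ij}$ for unordered pairs $i<j$ of nodes: minimize $\sum_{(i,j)\in E}x_{ij}+\sum_{i<j}\lambda(1-x_{ij})$ subject to $x_{ij}\le x_{ik}+x_{jk}$ for all $i,j,k$ and $0\le x_{ij}\le1$. Feasibility does not depend on $\lambda$. *)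

theory Defs
  imports "HOL-Library.FuncSet" "HOL-Library.Landau_Symbols"
begin

(* An undirected graph is a finite vertex set V with an edge set E of two-element
   subsets of V. *)

definition pairs :: "'a set \<Rightarrow> 'a set set" where
  "pairs V = {e. e \<subseteq> V \<and> card e = 2}"

definition ring_vertices :: "nat \<Rightarrow> nat set" where
  "ring_vertices n = {1..n}"

definition ring_edges :: "nat \<Rightarrow> nat set set" where
  "ring_edges n = {{i, i + 1} | i. 1 \<le> i \<and> i \<le> n - 1} \<union> {{1, n}}"

(* The variable x_ij with i < j is x {i, j}.  Extensionality fixes x outside the
   unordered pairs, so that distinct functions are distinct LP solutions and
   cardinalities of sets of solutions are meaningful. *)

definition lp_feasible :: "'a set \<Rightarrow> ('a set \<Rightarrow> real) set" where
  "lp_feasible V =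
     {x \<in> extensional (pairs V).
        (\<forall>i\<in>V. \<forall>j\<in>V. \<forall>k\<in>V. i \<noteq> j \<and> i \<noteq> k \<and> j \<noteq> k \<longrightarrow>
            x {i, j} \<le> x {i, k} + x {j, k}) \<and>
        (\<forall>e\<in>pairs V. 0 \<le> x e \<and> x e \<le> 1)}"

definition lp_objective ::
  "'a set \<Rightarrow> 'a set set \<Rightarrow> real \<Rightarrow> ('a set \<Rightarrow> real) \<Rightarrow> real" where
  "lp_objective V E lam x = (\<Sum>e\<in>E. x e) + (\<Sum>e\<in>pairs V. lam * (1 - x e))"

(* For finite V the feasible region is nonempty and compact, so the infimum is a minimum. *)

definition lp_opt :: "'a set \<Rightarrow> 'a set set \<Rightarrow> real \<Rightarrow> real" where
  "lp_opt V E lam = (INF x\<in>lp_feasible V. lp_objective V E lam x)"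

definition approximates ::
  "'a set \<Rightarrow> 'a set set \<Rightarrow> real \<Rightarrow> real set \<Rightarrow> ('a set \<Rightarrow> real) set \<Rightarrow> bool" where
  "approximates V E p \<Lambda> X \<longleftrightarrow>
     X \<subseteq> lp_feasible V \<and>
     (\<forall>lam\<in>\<Lambda>. \<exists>x\<in>X. lp_objective V E lam x \<le> p * lp_opt V E lam)"

definition gamma :: "real \<Rightarrow> real" where
  "gamma x = (2 * x\<^sup>2 - 1 + 2 * x * sqrt (x\<^sup>2 - 1))\<^sup>2"

definition M_const :: real where
  "M_const = 4 * sqrt 2 / 3"

definition size_bound :: "real \<Rightarrow> nat \<Rightarrow> int" where
  "size_bound p n = \<lceil>2 / 3 * log (gamma (p * M_const)) (real n / 4)\<rceil>"

end

(* Write a and b for the sum of x over the edges and of 1 - x over all pairs; a feasible x then has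
   objective a + lambda b.  The optimum on the ring is of order n sqrt lambda for lambda in
   [8/n^2, 1/2].  Above: cut the ring into blocks of D vertices, D about 1 / sqrt lambda, so that
   a = n/D and b <= n D.  Below: by the triangle inequality the pairs at distance d have total
   length at most d a, so if a is small then b >= D (n - D) - a D (D + 1) / 2 is large.

   If one x is p-approximate at l1 < l2, then a = O(p n sqrt l1) and b = O(p n / sqrt l2), and the
   lower bound at the geometric mean of l1 and l2 bounds l2 / l1 by a constant times p^4, which is
   less than gamma (p M)^3.  Hence the points (8/n^2) gamma (p M)^(3 j) of the parameter range
   need pairwise different solutions. *)

theory Submission
  imports Defs
begin

section \<open>Feasible solutions\<close>

lemma finite_pairs: "finite V \<Longrightarrow> finite (pairs V)"
  by (simp add: pairs_def)

lemma doubleton_in_pairs_iff: "{i, j} \<in> pairs V \<longleftrightarrow> i \<in> V \<and> j \<in> V \<and> i \<noteq> j"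
  by (auto simp: pairs_def card_insert_if)

lemma pairsE:
  assumes "e \<in> pairs V"
  obtains i j where "e = {i, j}" "i \<in> V" "j \<in> V" "i \<noteq> j"
  using assms unfolding pairs_def card_2_iff by auto

lemma lp_feasible_bounds:
  assumes "x \<in> lp_feasible V" "e \<in> pairs V"
  shows "0 \<le> x e" "x e \<le> 1"
  using assms by (auto simp: lp_feasible_def)

lemma lp_feasible_triangle:
  assumes "x \<in> lp_feasible V" "i \<in> V" "j \<in> V" "k \<in> V" "i \<noteq> j" "i \<noteq> k" "j \<noteq> k"
  shows "x {i, j} \<le> x {i, k} + x {j, k}"
  using assms by (auto simp: lp_feasible_def)

lemma lp_objective_eq:
  "lp_objective V E lam x = (\<Sum>e\<in>E. x e) + lam * (\<Sum>e\<in>pairs V. 1 - x e)"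
  by (simp add: lp_objective_def sum_distrib_left)

lemma edge_sum_nonneg:
  assumes "x \<in> lp_feasible V" "E \<subseteq> pairs V"
  shows "0 \<le> (\<Sum>e\<in>E. x e)"
  using assms by (auto intro!: sum_nonneg dest: lp_feasible_bounds)

lemma pair_sum_nonneg:
  assumes "x \<in> lp_feasible V"
  shows "0 \<le> (\<Sum>e\<in>pairs V. 1 - x e)"
  using assms by (auto intro!: sum_nonneg dest: lp_feasible_bounds)

text \<open>An infimum over reals is a lower bound only when the set of values is bounded below;
  here 0 bounds it, since both sums in the objective are nonnegative.\<close>

lemma lp_opt_le:
  assumes "x \<in> lp_feasible V" "E \<subseteq> pairs V" "0 \<le> lam"
  shows "lp_opt V E lam \<le> lp_objective V E lam x"
  unfolding lp_opt_def
proof (rule cINF_lower)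
  show "bdd_below (lp_objective V E lam ` lp_feasible V)"
    using assms(2,3)
    by (auto intro!: bdd_belowI[of _ 0] add_nonneg_nonneg mult_nonneg_nonneg
        edge_sum_nonneg pair_sum_nonneg simp: lp_objective_eq)
qed fact

text \<open>The cut metric of the clustering whose clusters are the fibres of \<open>c\<close>. It
  is phrased by quantifiers over the set \<open>e\<close>, so no order of the two endpoints has to
  be chosen, and restricted to \<open>pairs V\<close> because feasible solutions are
  extensional.\<close>

definition cluster_solution :: "'a set \<Rightarrow> ('a \<Rightarrow> 'b) \<Rightarrow> 'a set \<Rightarrow> real" where
  "cluster_solution V c = restrict (\<lambda>e. of_bool (\<exists>u\<in>e. \<exists>v\<in>e. c u \<noteq> c v)) (pairs V)"

lemma cluster_solution_doubleton:
  assumes "i \<in> V" "j \<in> V" "i \<noteq> j"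
  shows "cluster_solution V c {i, j} = of_bool (c i \<noteq> c j)"
  using assms by (auto simp: cluster_solution_def doubleton_in_pairs_iff)

text \<open>Triangle inequality: if \<open>c i\<close> and \<open>c j\<close> differ, then
  \<open>c k\<close> differs from at least one of them.\<close>

lemma cluster_solution_feasible: "cluster_solution V c \<in> lp_feasible V"
  unfolding lp_feasible_def mem_Collect_eq
proof (intro conjI ballI impI)
  show "cluster_solution V c \<in> extensional (pairs V)"
    by (simp add: cluster_solution_def)
qed (auto simp: cluster_solution_doubleton elim!: pairsE)

section \<open>The ring\<close>

lemma finite_ring_edges: "finite (ring_edges n)"
proof -
  have "{{i, i + 1} |i. 1 \<le> i \<and> i \<le> n - 1} = (\<lambda>i. {i, i + 1}) ` {1..n - 1}"
    by auto
  then show ?thesis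
    by (simp add: ring_edges_def)
qed

lemma ring_edges_subset_pairs:
  assumes "2 \<le> n"
  shows "ring_edges n \<subseteq> pairs (ring_vertices n)"
  using assms by (auto simp: ring_edges_def ring_vertices_def doubleton_in_pairs_iff)

section \<open>Lower bound for the objective on the ring\<close>

lemma path_sum_le_ring_sum:
  assumes "x \<in> lp_feasible (ring_vertices n)" "2 \<le> n"
  shows "(\<Sum>i=1..n - 1. x {i, i + 1}) \<le> (\<Sum>e\<in>ring_edges n. x e)"
proof -
  have "inj_on (\<lambda>i. {i, i + 1}) {1..n - 1}"
    by (auto simp: inj_on_def doubleton_eq_iff)
  then have "(\<Sum>i=1..n - 1. x {i, i + 1}) = (\<Sum>e\<in>(\<lambda>i. {i, i + 1}) ` {1..n - 1}. x e)"
    by (simp add: sum.reindex)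
  also have "\<dots> \<le> (\<Sum>e\<in>ring_edges n. x e)"
    using finite_ring_edges assms ring_edges_subset_pairs[OF assms(2)]
    by (intro sum_mono2) (auto simp: ring_edges_def intro: lp_feasible_bounds)
  finally show ?thesis .
qed

text \<open>Walking from i to i + d takes d path edges, and each path edge is used by at most d such
  walks. The induction on \<open>d\<close> appends one edge to every walk. Distance means difference
  of labels, so no walk passes through the edge {1, n}.\<close>

lemma distance_sum_le:
  assumes x: "x \<in> lp_feasible (ring_vertices n)" and "1 \<le> d" "d < n"
  shows "(\<Sum>i=1..n - d. x {i, i + d}) \<le> real d * (\<Sum>i=1..n - 1. x {i, i + 1})"
  using assms(2,3)
proof (induction d rule: dec_induct)
  case base
  then show ?case by simp
next
  case (step d)
  have nonneg: "0 \<le> x {i, j}" if "1 \<le> i" "i < j" "j \<le> n" for i j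
    using that by (intro lp_feasible_bounds[OF x])
      (auto simp: doubleton_in_pairs_iff ring_vertices_def)
  have "(\<Sum>i=1..n - Suc d. x {i, i + Suc d})
      \<le> (\<Sum>i=1..n - Suc d. x {i, i + d} + x {i + d, i + d + 1})"
  proof (rule sum_mono)
    fix i assume "i \<in> {1..n - Suc d}"
    then have "x {i, i + Suc d} \<le> x {i, i + d} + x {i + Suc d, i + d}"
      using step.hyps by (intro lp_feasible_triangle[OF x]) (auto simp: ring_vertices_def)
    then show "x {i, i + Suc d} \<le> x {i, i + d} + x {i + d, i + d + 1}"
      by (simp add: insert_commute)
  qed
  \<comment> \<open>After a shift by \<open>d\<close> the appended edges are those with index 1 + d
    to n - 1, each exactly once, so together they cost at most one full path sum.\<close>
  also have "\<dots> = (\<Sum>i=1..n - Suc d. x {i, i + d})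
      + (\<Sum>i=1 + d..n - Suc d + d. x {i, i + 1})"
    by (simp only: sum.distrib sum.shift_bounds_cl_nat_ivl)
  also have "(\<Sum>i=1..n - Suc d. x {i, i + d}) \<le> (\<Sum>i=1..n - d. x {i, i + d})"
    using step.hyps by (intro sum_mono2) (auto intro!: nonneg)
  also have "(\<Sum>i=1 + d..n - Suc d + d. x {i, i + 1}) \<le> (\<Sum>i=1..n - 1. x {i, i + 1})"
    using step.prems by (intro sum_mono2) (auto intro!: nonneg)
  also have "(\<Sum>i=1..n - d. x {i, i + d}) \<le> real d * (\<Sum>i=1..n - 1. x {i, i + 1})"
    using step by simp
  finally show ?case
    by (simp add: algebra_simps)
qed

text \<open>Only pairs with label difference d in 1..D are counted. There are n - d, hence at least
  n - D, of them for each d, and their total length is at most d times the edge sum. Summing over d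
  gives the bound; distinct (d, i) give distinct pairs, and the remaining pairs contribute
  nonnegative terms.\<close>

lemma ring_pair_sum_ge:
  assumes x: "x \<in> lp_feasible (ring_vertices n)" and "2 \<le> n" "D < n"
  shows "real D * (real n - real D) - (\<Sum>e\<in>ring_edges n. x e) * (real D * (real D + 1) / 2)
    \<le> (\<Sum>e\<in>pairs (ring_vertices n). 1 - x e)"
proof -
  define a where "a = (\<Sum>e\<in>ring_edges n. x e)"
  have each: "real n - real D - real d * a \<le> (\<Sum>i=1..n - d. 1 - x {i, i + d})"
    if "d \<in> {1..D}" for d
  proof -
    have "(\<Sum>i=1..n - d. x {i, i + d}) \<le> real d * (\<Sum>i=1..n - 1. x {i, i + 1})"
      using that assms by (intro distance_sum_le[OF x]) auto
    also have "\<dots> \<le> real d * a"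
      unfolding a_def using path_sum_le_ring_sum[OF x] assms by (intro mult_left_mono) auto
    finally have "(\<Sum>i=1..n - d. x {i, i + d}) \<le> real d * a" .
    moreover have "real (n - d) \<ge> real n - real D"
      using that assms by auto
    ultimately show ?thesis
      by (simp add: sum_subtractf)
  qed
  have "(\<Sum>d=1..D. real d) = real D * (real D + 1) / 2"
    by (induction D) (auto simp: field_simps)
  then have "real D * (real n - real D) - a * (real D * (real D + 1) / 2)
      = (\<Sum>d=1..D. real n - real D - real d * a)"
    by (simp add: sum_subtractf flip: sum_distrib_right)
  also have "\<dots> \<le> (\<Sum>d=1..D. \<Sum>i=1..n - d. 1 - x {i, i + d})"
    by (rule sum_mono) (rule each)
  also have "\<dots> = (\<Sum>(d, i)\<in>Sigma {1..D} (\<lambda>d. {1..n - d}). 1 - x {i, i + d})"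
    by (rule sum.Sigma) auto
  also have "\<dots> = (\<Sum>e\<in>(\<lambda>(d, i). {i, i + d}) ` Sigma {1..D} (\<lambda>d. {1..n - d}). 1 - x e)"
    by (subst sum.reindex) (auto simp: inj_on_def doubleton_eq_iff intro!: sum.cong)
  also have "\<dots> \<le> (\<Sum>e\<in>pairs (ring_vertices n). 1 - x e)"
    using assms by (intro sum_mono2 finite_pairs)
      (auto simp: ring_vertices_def doubleton_in_pairs_iff dest: lp_feasible_bounds[rotated])
  finally show ?thesis
    by (simp add: a_def)
qed

lemma ring_objective_ge:
  assumes x: "x \<in> lp_feasible (ring_vertices n)"
    and lam: "8 / (real n)\<^sup>2 \<le> lam" "lam \<le> 1" and n: "2 \<le> n"
  shows "real n * sqrt lam / 5 \<le> lp_objective (ring_vertices n) (ring_edges n) lam x"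
proof -
  define a where "a = (\<Sum>e\<in>ring_edges n. x e)"
  define b where "b = (\<Sum>e\<in>pairs (ring_vertices n). 1 - x e)"
  have obj: "lp_objective (ring_vertices n) (ring_edges n) lam x = a + lam * b"
    by (simp add: lp_objective_eq a_def b_def)
  have a0: "0 \<le> a" and b0: "0 \<le> b"
    unfolding a_def b_def
    using edge_sum_nonneg[OF x ring_edges_subset_pairs[OF n]] pair_sum_nonneg[OF x] by auto
  have lam0: "0 < lam"
    using n by (intro less_le_trans[OF _ lam(1)]) simp
  define r where "r = sqrt lam"
  have r: "0 < r" "r \<le> 1" "lam = r\<^sup>2"
    using lam0 lam(2) by (auto simp: r_def)
  \<comment> \<open>8 / 3 is a rational lower bound for sqrt 8; it serves to give D \<le> 3 n / 8
    below.\<close>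
  have rn: "8 / 3 \<le> r * real n"
  proof (rule power2_le_imp_le)
    have "8 \<le> lam * (real n)\<^sup>2"
      using lam(1) n by (simp add: field_simps)
    then show "(8 / 3)\<^sup>2 \<le> (r * real n)\<^sup>2"
      by (simp add: power_mult_distrib r power_divide)
  qed (use r in auto)
  \<comment> \<open>This scale balances the two terms: \<open>r * real D\<close> lies between 1/2
    and 1, so n / D and \<open>lam\<close> n D are both of order n \<open>r\<close>.\<close>
  define D where "D = nat \<lfloor>1 / r\<rfloor>"
  have "1 \<le> 1 / r"
    using r by simp
  then have D1: "1 \<le> D"
    unfolding D_def by (intro le_nat_floor) simp
  have Dle: "real D \<le> 1 / r" and Dgt: "1 / r < real D + 1"
    unfolding D_def using r by (auto simp: of_nat_nat floor_less_iff)
  have rD: "r * real D \<le> 1" "1 \<le> 2 * (r * real D)"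
  proof -
    show "r * real D \<le> 1"
      using Dle r by (simp add: field_simps)
    have "1 < r * (real D + 1)"
      using Dgt r by (simp add: field_simps)
    also have "\<dots> \<le> r * (2 * real D)"
      using D1 r by (intro mult_left_mono) auto
    finally show "1 \<le> 2 * (r * real D)" by simp
  qed
  have Dn: "real D \<le> 3 / 8 * real n"
  proof -
    have "r * real D \<le> r * (3 / 8 * real n)"
      using rn rD by simp
    then show ?thesis
      using r by simp
  qed
  show ?thesis
  proof (cases "real n * r / 5 \<le> a")
    case True
    then show ?thesis
      using b0 lam0 obj by (simp add: r_def add_increasing2)
  next
    \<comment> \<open>A small edge sum forces many close pairs: a D \<le> n / 5 and D \<le> 3 n / 8
      leave b \<ge> (5/8 - 1/5) n D = 17/40 n D. Rounding down to 2/5 yields exactly n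
      \<open>r\<close> / 5, because 2 \<open>r\<close> D \<ge> 1.\<close>
    case False
    have "a * (real D * (real D + 1) / 2) \<le> a * (real D * real D)"
      using a0 D1 by (intro mult_left_mono) (auto simp: field_simps)
    also have "\<dots> = (a * real D) * real D"
      by simp
    also have "\<dots> \<le> real n / 5 * real D"
    proof (rule mult_right_mono)
      have "a * real D \<le> real n * r / 5 * real D"
        using False by (intro mult_right_mono) auto
      also have "\<dots> = real n / 5 * (r * real D)"
        by simp
      also have "\<dots> \<le> real n / 5"
        using rD(1) by (simp add: mult_left_le)
      finally show "a * real D \<le> real n / 5" .
    qed simp
    finally have "a * (real D * (real D + 1) / 2) \<le> real n / 5 * real D" .
    moreover have "real D * (5 / 8 * real n) \<le> real D * (real n - real D)"
      using Dn by (intro mult_left_mono) auto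
    moreover have "real D * (real n - real D) - a * (real D * (real D + 1) / 2) \<le> b"
      unfolding a_def b_def using Dn n by (intro ring_pair_sum_ge[OF x]) linarith+
    ultimately have "17 / 40 * (real n * real D) \<le> b"
      by (simp add: mult.commute)
    moreover have "2 / 5 * (real n * real D) \<le> 17 / 40 * (real n * real D)"
      by (rule mult_right_mono) auto
    ultimately have b: "2 / 5 * (real n * real D) \<le> b"
      by linarith
    have "real n * r / 5 * 1 \<le> real n * r / 5 * (2 * (r * real D))"
      using rD(2) r by (intro mult_left_mono) auto
    also have "\<dots> = lam * (2 / 5 * (real n * real D))"
      by (simp add: r power2_eq_square)
    also have "\<dots> \<le> lam * b"
      using b lam0 by (intro mult_left_mono) auto
    finally show ?thesis
      using a0 obj by (simp add: r_def)
  qed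
qed

section \<open>Upper bound for the optimum by cutting the ring into blocks\<close>

text \<open>Labels start at 1, so \<open>(i - 1) div D\<close> makes 1..D the first block. Since D
  divides n, all blocks are full, and each of the n / D blocks has one edge leaving it in increasing
  direction around the ring.\<close>

lemma ring_block_edge_sum_le:
  assumes "D dvd n" "0 < D" "2 \<le> n"
  shows "(\<Sum>e\<in>ring_edges n. cluster_solution (ring_vertices n) (\<lambda>i. (i - 1) div D) e)
    \<le> real n / real D"
proof -
  let ?x = "cluster_solution (ring_vertices n) (\<lambda>i. (i - 1) div D)"
  \<comment> \<open>The edge at the upper end of block m; for the last block this is the closing
    edge {1, n}. Every edge outside the image of \<open>g\<close> stays inside a block and has value
    0.\<close>
  define g where "g m = (if m * D = n then {1, n} else {m * D, m * D + 1})" for m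
  have "?x e = 0" if e: "e \<in> ring_edges n - g ` {1..n div D}" for e
  proof -
    have "D \<le> n"
      using assms by (intro dvd_imp_le) auto
    then have "n div D \<in> {1..n div D}"
      using assms(2) by (simp add: Suc_le_eq div_greater_zero_iff)
    moreover have "g (n div D) = {1, n}"
      using assms(1) by (simp add: g_def)
    ultimately have "{1, n} \<in> g ` {1..n div D}"
      by (metis imageI)
    then have "e \<noteq> {1, n}"
      using e by auto
    then obtain i where i: "e = {i, i + 1}" "1 \<le> i" "i \<le> n - 1"
      using e by (auto simp: ring_edges_def)
    have "\<not> D dvd i"
    proof
      assume "D dvd i"
      then obtain m where m: "i = m * D"
        by (metis dvd_def mult.commute)
      have "m * D \<le> n"
        using i m by simp
      then have "m \<le> n div D"
        using assms(2) by (simp add: less_eq_div_iff_mult_less_eq)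
      moreover have "g m = e"
        using i m assms by (auto simp: g_def)
      moreover have "1 \<le> m"
        using i m by (cases m) auto
      ultimately show False
        using e by auto
    qed
    then have "(i - 1) div D = i div D"
      using i div_Suc[of "i - 1" D] by (auto simp: dvd_eq_mod_eq_0)
    then show ?thesis
      unfolding i(1) using i assms
      by (subst cluster_solution_doubleton) (auto simp: ring_vertices_def)
  qed
  then have "(\<Sum>e\<in>ring_edges n. ?x e) = (\<Sum>e\<in>ring_edges n \<inter> g ` {1..n div D}. ?x e)"
    by (intro sum.mono_neutral_right) (auto simp: finite_ring_edges)
  also have "\<dots> \<le> (\<Sum>e\<in>ring_edges n \<inter> g ` {1..n div D}. 1)"
    using ring_edges_subset_pairs[OF assms(3)]
    by (intro sum_mono) (auto intro: lp_feasible_bounds[OF cluster_solution_feasible])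
  also have "\<dots> = real (card (ring_edges n \<inter> g ` {1..n div D}))"
    by simp
  also have "card (ring_edges n \<inter> g ` {1..n div D}) \<le> card (g ` {1..n div D})"
    by (intro card_mono) auto
  also have "card (g ` {1..n div D}) \<le> n div D"
    using card_image_le[of "{1..n div D}" g] by simp
  also have "real (n div D) = real n / real D"
    using assms by (simp add: real_of_nat_div)
  finally show ?thesis
    by simp
qed

lemma ring_block_pair_sum_le:
  assumes "0 < D"
  shows "(\<Sum>e\<in>pairs (ring_vertices n).
      1 - cluster_solution (ring_vertices n) (\<lambda>i. (i - 1) div D) e) \<le> real n * real D"
proof -
  let ?V = "ring_vertices n"
  let ?x = "cluster_solution ?V (\<lambda>i. (i - 1) div D)"
  \<comment> \<open>A superset of the pairs inside blocks that is easy to count: two members of one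
    block differ by less than D. It may contain sets reaching beyond n, which the intersection with
    \<open>pairs ?V\<close> removes.\<close>
  define S where "S = (\<lambda>(i, d). {i, i + d}) ` ({1..n} \<times> {1..D})"
  have close: "{i, j} \<in> S" if "1 \<le> i" "i < j" "j \<le> n" "(i - 1) div D = (j - 1) div D" for i j
  proof -
    have "i - 1 = (j - 1) div D * D + (i - 1) mod D"
      using that(4) by (metis div_mult_mod_eq)
    then have "j - 1 - (i - 1) < D"
      using mod_less_divisor[OF assms, of "j - 1"] div_mult_mod_eq[of "j - 1" D] by linarith
    then show ?thesis
      using that unfolding S_def by (intro image_eqI[of _ _ "(i, j - i)"]) auto
  qed
  have "1 - ?x e = 0" if e: "e \<in> pairs ?V - S" for e
  proof -
    from e obtain i j where ij: "e = {i, j}" "i \<in> ?V" "j \<in> ?V" "i \<noteq> j"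
      by (auto elim: pairsE)
    then have "(i - 1) div D \<noteq> (j - 1) div D"
      using e close[of i j] close[of j i]
      by (cases i j rule: linorder_cases) (auto simp: ring_vertices_def insert_commute)
    then show ?thesis
      using ij by (simp add: cluster_solution_doubleton)
  qed
  then have "(\<Sum>e\<in>pairs ?V. 1 - ?x e) = (\<Sum>e\<in>pairs ?V \<inter> S. 1 - ?x e)"
    by (intro sum.mono_neutral_right) (auto simp: finite_pairs ring_vertices_def)
  also have "\<dots> \<le> (\<Sum>e\<in>pairs ?V \<inter> S. 1)"
    by (intro sum_mono) (auto intro: lp_feasible_bounds[OF cluster_solution_feasible])
  also have "\<dots> = real (card (pairs ?V \<inter> S))"
    by simp
  also have "card (pairs ?V \<inter> S) \<le> card S"
    by (intro card_mono) (auto simp: S_def)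
  also have "card S \<le> n * D"
    unfolding S_def using card_image_le[of "{1..n} \<times> {1..D}"] by (simp add: card_cartesian_product)
  finally show ?thesis
    by simp
qed

text \<open>The block length is the largest power of two not exceeding 1 / \<open>r\<close>. As n is
  itself a power of two, it divides n; rounding to a power of two costs at most a factor 2. The cut
  edges contribute 2 n \<open>r\<close> and the pairs inside blocks n \<open>r\<close>.\<close>

lemma ring_lp_opt_le:
  assumes n: "n = 2 ^ k" "2 \<le> n" and lam: "1 / (real n)\<^sup>2 \<le> lam" "lam \<le> 1"
  shows "lp_opt (ring_vertices n) (ring_edges n) lam \<le> 3 * real n * sqrt lam"
proof -
  have lam0: "0 < lam"
    using n(2) by (intro less_le_trans[OF _ lam(1)]) simp
  define r where "r = sqrt lam"
  have r: "0 < r" "r \<le> 1" "lam = r\<^sup>2"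
    using lam0 lam(2) by (auto simp: r_def)
  have rn: "1 \<le> r * real n"
  proof (rule power2_le_imp_le)
    show "1\<^sup>2 \<le> (r * real n)\<^sup>2"
      using lam(1) n(2) by (simp add: field_simps r)
  qed (use r in auto)
  have "1 \<le> 1 / r"
    using r by simp
  then have "1 \<le> nat \<lfloor>1 / r\<rfloor>"
    by (intro le_nat_floor) simp
  then obtain j where "2 ^ j \<le> nat \<lfloor>1 / r\<rfloor>" "nat \<lfloor>1 / r\<rfloor> < 2 ^ Suc j"
    using ex_power_ivl1[of 2 "nat \<lfloor>1 / r\<rfloor>"] by auto
  moreover have "0 \<le> \<lfloor>1 / r\<rfloor>"
    using r by simp
  ultimately have "int (2 ^ j) \<le> \<lfloor>1 / r\<rfloor>" "\<lfloor>1 / r\<rfloor> < int (2 ^ Suc j)"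
    by (auto simp: le_nat_iff nat_less_iff)
  then have j: "2 ^ j \<le> 1 / r" "1 / r < 2 ^ Suc j"
    by (simp_all add: le_floor_iff floor_less_iff)
  define D :: nat where "D = 2 ^ j"
  have rD: "r * real D \<le> 1" "1 \<le> 2 * (r * real D)"
    using j r by (auto simp: D_def field_simps)
  \<comment> \<open>D \<le> n, and between powers of two this already implies divisibility.\<close>
  have "r * real D \<le> r * real n"
    using rD rn by simp
  then have "(2::nat) ^ j \<le> 2 ^ k"
    using r n D_def by simp
  then have dvd: "D dvd n"
    unfolding D_def n by (simp add: le_imp_power_dvd)
  have D0: "0 < D"
    by (simp add: D_def)
  let ?x = "cluster_solution (ring_vertices n) (\<lambda>i. (i - 1) div D)"
  have "lp_opt (ring_vertices n) (ring_edges n) lam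
      \<le> lp_objective (ring_vertices n) (ring_edges n) lam ?x"
    using lam0 by (intro lp_opt_le cluster_solution_feasible ring_edges_subset_pairs n) auto
  also have "\<dots> \<le> real n / real D + lam * (real n * real D)"
    unfolding lp_objective_eq
    using lam0 ring_block_edge_sum_le[OF dvd D0 n(2)] ring_block_pair_sum_le[OF D0]
    by (intro add_mono mult_left_mono) auto
  also have "real n / real D \<le> 2 * real n * r"
  proof -
    have "real n * 1 \<le> real n * (2 * (r * real D))"
      using rD by (intro mult_left_mono) auto
    then show ?thesis
      using D0 by (simp add: field_simps)
  qed
  also have "lam * (real n * real D) \<le> real n * r"
  proof -
    have "lam * (real n * real D) = real n * r * (r * real D)"
      by (simp add: r power2_eq_square)
    also have "\<dots> \<le> real n * r * 1"
      using rD r by (intro mult_left_mono) auto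
    finally show ?thesis by simp
  qed
  finally show ?thesis
    by (simp add: r_def)
qed

section \<open>Separation of the parameters\<close>

lemma approximation_ratio_le:
  assumes x: "x \<in> lp_feasible (ring_vertices n)" and n: "n = 2 ^ k" "2 \<le> n" and p: "0 < p"
    and l: "8 / (real n)\<^sup>2 \<le> l1" "l1 \<le> l2" "l2 \<le> 1"
    and l1: "lp_objective (ring_vertices n) (ring_edges n) l1 x
        \<le> p * lp_opt (ring_vertices n) (ring_edges n) l1"
    and l2: "lp_objective (ring_vertices n) (ring_edges n) l2 x
        \<le> p * lp_opt (ring_vertices n) (ring_edges n) l2"
  shows "l2 / l1 \<le> (30 * p) ^ 4"
proof -
  let ?obj = "lp_objective (ring_vertices n) (ring_edges n)"
  define a where "a = (\<Sum>e\<in>ring_edges n. x e)"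
  define b where "b = (\<Sum>e\<in>pairs (ring_vertices n). 1 - x e)"
  have obj: "?obj lam x = a + lam * b" for lam
    by (simp add: lp_objective_eq a_def b_def)
  have a0: "0 \<le> a" and b0: "0 \<le> b"
    unfolding a_def b_def
    using edge_sum_nonneg[OF x ring_edges_subset_pairs[OF n(2)]] pair_sum_nonneg[OF x] by auto
  have "0 < l1"
    using n(2) by (intro less_le_trans[OF _ l(1)]) simp
  moreover have "1 / (real n)\<^sup>2 \<le> l1"
    by (rule order_trans[OF _ l(1)]) (simp add: divide_right_mono)
  ultimately have pos: "0 < l1" "0 < l2"
    and low: "1 / (real n)\<^sup>2 \<le> l1" "1 / (real n)\<^sup>2 \<le> l2"
    using l(2) by auto
  define s where "s = sqrt l1"
  define t where "t = sqrt l2"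
  have s: "0 < s" "l1 = s\<^sup>2" and t: "0 < t" "l2 = t\<^sup>2" and st: "s \<le> t"
    using pos l by (auto simp: s_def t_def)
  have "p * lp_opt (ring_vertices n) (ring_edges n) l1 \<le> p * (3 * real n * s)"
    unfolding s_def using p l low by (intro mult_left_mono ring_lp_opt_le[OF n]) auto
  then have "a + l1 * b \<le> 3 * p * real n * s"
    using l1 obj by simp
  \<comment> \<open>The smaller parameter controls the edge sum, the larger one the pair
    sum.\<close>
  then have a: "a \<le> 3 * p * real n * s"
    using b0 pos by (smt (verit) mult_nonneg_nonneg)
  have "p * lp_opt (ring_vertices n) (ring_edges n) l2 \<le> p * (3 * real n * t)"
    unfolding t_def using p l low by (intro mult_left_mono ring_lp_opt_le[OF n]) auto
  then have "a + t * (t * b) \<le> t * (3 * p * real n)"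
    using l2 unfolding obj t(2) by (simp add: power2_eq_square algebra_simps)
  then have "t * (t * b) \<le> t * (3 * p * real n)"
    using a0 by linarith
  then have b: "t * b \<le> 3 * p * real n"
    using t(1) by (rule mult_left_le_imp_le)
  have mean: "l1 \<le> s * t" "s * t \<le> l2"
    using s t st by (auto simp: power2_eq_square)
  \<comment> \<open>The geometric mean of \<open>l1\<close> and \<open>l2\<close> is s t. There the
    lower bound n sqrt (s t) / 5 meets the upper bound 6 p n s, whence sqrt (t / s) \<le> 30 p; the
    fourth power of this is the claim.\<close>
  have "real n * sqrt (s * t) / 5 \<le> a + (s * t) * b"
    unfolding obj[symmetric] using l mean n by (intro ring_objective_ge[OF x]) auto
  also have "\<dots> = a + s * (t * b)"
    by simp
  also have "\<dots> \<le> 3 * p * real n * s + s * (3 * p * real n)"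
    using a b s by (intro add_mono mult_left_mono) auto
  finally have "real n * sqrt (s * t) \<le> real n * (30 * p * s)"
    by (simp add: algebra_simps)
  then have "sqrt (s * t) \<le> 30 * p * s"
    using n(2) by simp
  then have "(sqrt (s * t))\<^sup>2 \<le> (30 * p * s)\<^sup>2"
    using s t by (intro power_mono) auto
  then have "s * t \<le> s * ((30 * p)\<^sup>2 * s)"
    using s t by (simp add: power2_eq_square algebra_simps)
  then have "t \<le> (30 * p)\<^sup>2 * s"
    using s by simp
  then have "t\<^sup>2 \<le> ((30 * p)\<^sup>2 * s)\<^sup>2"
    using t by (intro power_mono) auto
  also have "\<dots> = (30 * p) ^ 4 * l1"
    by (simp add: power_mult_distrib s)
  finally show ?thesis
    using pos t by (simp add: field_simps)
qed

section \<open>Estimates for the function gamma\<close>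

lemma gamma_eq:
  assumes "1 \<le> y"
  shows "gamma y = (y + sqrt (y\<^sup>2 - 1)) ^ 4"
proof -
  have "(sqrt (y\<^sup>2 - 1))\<^sup>2 = y\<^sup>2 - 1"
    using assms by simp
  then have "(y + sqrt (y\<^sup>2 - 1))\<^sup>2 = 2 * y\<^sup>2 - 1 + 2 * y * sqrt (y\<^sup>2 - 1)"
    by (simp add: power2_sum)
  moreover have "(y + sqrt (y\<^sup>2 - 1)) ^ 4 = ((y + sqrt (y\<^sup>2 - 1))\<^sup>2)\<^sup>2"
    by (simp flip: power_mult)
  ultimately show ?thesis
    by (simp only: gamma_def)
qed

text \<open>For y \<ge> 5/3 one has 1 \<le> 9/25 y^2, so sqrt (y^2 - 1) \<ge> 4/5 y. Equality at y =
  5/3 comes from the 3-4-5 triangle.\<close>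

lemma gamma_ge:
  assumes "5 / 3 \<le> y"
  shows "(9 / 5 * y) ^ 4 \<le> gamma y"
proof -
  have "(5 / 3)\<^sup>2 \<le> y\<^sup>2"
    using assms by (intro power_mono) auto
  then have "4 / 5 * y \<le> sqrt (y\<^sup>2 - 1)"
    by (intro real_le_rsqrt) (simp add: power_mult_distrib power2_eq_square)
  then have "9 / 5 * y \<le> y + sqrt (y\<^sup>2 - 1)"
    by simp
  then show ?thesis
    using assms by (subst gamma_eq) (auto intro!: power_mono)
qed

lemma M_const_bounds: "5 / 3 \<le> M_const" "M_const ^ 4 = 1024 / 81"
proof -
  have "5 / 4 \<le> sqrt (2::real)"
    by (intro real_le_rsqrt) (simp add: power2_eq_square)
  then show "5 / 3 \<le> M_const"
    by (simp add: M_const_def)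
  have "(sqrt 2) ^ 4 = ((sqrt (2::real))\<^sup>2)\<^sup>2"
    by (simp only: flip: power_mult) simp
  then have "(sqrt (2::real)) ^ 4 = 4"
    by simp
  then show "M_const ^ 4 = 1024 / 81"
    by (simp add: M_const_def power_divide power_mult_distrib)
qed

lemma gamma_M_const_bounds:
  assumes "1 \<le> p"
  shows "1 < gamma (p * M_const)" "(30 * p) ^ 4 < gamma (p * M_const) ^ 3"
proof -
  have "1 * (5 / 3) \<le> p * M_const"
    using assms M_const_bounds(1) by (intro mult_mono) auto
  then have "(9 / 5 * (p * M_const)) ^ 4 \<le> gamma (p * M_const)"
    by (intro gamma_ge) auto
  moreover have "(9 / 5 * (p * M_const)) ^ 4 = (9 / 5) ^ 4 * (1024 / 81) * p ^ 4"
    by (simp only: power_mult_distrib M_const_bounds mult_ac)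
  ultimately have ge: "(9 / 5) ^ 4 * (1024 / 81) * p ^ 4 \<le> gamma (p * M_const)"
    by simp
  have p4: "1 \<le> p ^ 4"
    using assms by simp
  show "1 < gamma (p * M_const)"
    using ge p4 by (simp add: power_divide)
  \<comment> \<open>The factor (9/5)^4 * 1024/81 is about 132.7, so its cube exceeds 2 million while
    30^4 is 810000. Its square, about 17600, would be too small, which is why the third power of
    \<open>gamma\<close> appears.\<close>
  have "30 ^ 4 * p ^ 4 < ((9 / 5) ^ 4 * (1024 / 81)) ^ 3 * p ^ 4"
    using assms by (intro mult_strict_right_mono) (simp_all add: power_divide)
  also have "\<dots> \<le> ((9 / 5) ^ 4 * (1024 / 81)) ^ 3 * (p ^ 4) ^ 3"
    using p4 by (intro mult_left_mono self_le_power[OF p4]) simp_all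
  also have "\<dots> = ((9 / 5) ^ 4 * (1024 / 81) * p ^ 4) ^ 3"
    by (simp only: power_mult_distrib)
  also have "\<dots> \<le> gamma (p * M_const) ^ 3"
    using ge p4 by (intro power_mono) auto
  finally show "(30 * p) ^ 4 < gamma (p * M_const) ^ 3"
    by (simp add: power_mult_distrib)
qed

section \<open>Counting separated parameters\<close>

lemma size_bound_le_card:
  assumes p: "1 < p" and n: "n = 2 ^ k" "4 \<le> n" and fin: "finite X"
    and appr: "approximates (ring_vertices n) (ring_edges n) p {8 / (real n)\<^sup>2 .. 1 / 2} X"
  shows "size_bound p n \<le> int (card X)"
proof -
  let ?obj = "lp_objective (ring_vertices n) (ring_edges n)"
  let ?opt = "lp_opt (ring_vertices n) (ring_edges n)"
  define \<Gamma> where "\<Gamma> = gamma (p * M_const) ^ 3"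
  define L where "L = 8 / (real n)\<^sup>2"
  have g1: "1 < gamma (p * M_const)" and \<Gamma>gt: "(30 * p) ^ 4 < \<Gamma>"
    using gamma_M_const_bounds[of p] p by (auto simp: \<Gamma>_def)
  have \<Gamma>1: "1 < \<Gamma>"
    using g1 by (simp add: \<Gamma>_def one_less_power)
  have L0: "0 < L"
    using n(2) by (simp add: L_def)
  define N where "N = nat (size_bound p n)"
  \<comment> \<open>The parameter range has endpoint ratio (n / 4)^2, so the condition on j is
    \<open>gamma (p * M_const)\<close> ^ (3 j) \<le> (n / 4)^2. This is where the factor 2/3 in
    \<open>size_bound\<close> comes from. An integer below a ceiling is below the number itself, so
    all j < \<open>N\<close> qualify.\<close>
  have range: "L * \<Gamma> ^ j \<in> {8 / (real n)\<^sup>2 .. 1 / 2}" if "j < N" for j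
  proof -
    have "int j < size_bound p n"
      using that by (simp add: N_def)
    then have "real j < 2 / 3 * log (gamma (p * M_const)) (real n / 4)"
      unfolding size_bound_def by (simp add: less_ceiling_iff)
    then have "real (3 * j) < log (gamma (p * M_const)) ((real n / 4)\<^sup>2)"
      using n(2) by (simp add: log_nat_power)
    then have "gamma (p * M_const) ^ (3 * j) < (real n / 4)\<^sup>2"
      using g1 n(2) by (simp add: less_log_iff powr_realpow del: of_nat_mult)
    then have "\<Gamma> ^ j \<le> (real n / 4)\<^sup>2"
      by (simp add: \<Gamma>_def power_mult)
    then have "L * \<Gamma> ^ j \<le> L * (real n / 4)\<^sup>2"
      using L0 by (intro mult_left_mono) auto
    also have "\<dots> = 1 / 2"
      using n(2) by (simp add: L_def power_divide)
    finally show ?thesis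
      using \<Gamma>1 L0 mult_left_mono[of 1 "\<Gamma> ^ j" L] by (simp add: L_def)
  qed
  have "\<exists>x\<in>X. ?obj (L * \<Gamma> ^ j) x \<le> p * ?opt (L * \<Gamma> ^ j)" if "j < N" for j
    using appr range[OF that] by (auto simp: approximates_def)
  then obtain f where f: "\<And>j. j < N \<Longrightarrow> f j \<in> X"
      "\<And>j. j < N \<Longrightarrow> ?obj (L * \<Gamma> ^ j) (f j) \<le> p * ?opt (L * \<Gamma> ^ j)"
    by metis
  \<comment> \<open>A solution shared by two indices would bound the ratio
    \<open>\<Gamma> ^ (j - i)\<close> by (30 p)^4, yet this ratio is at least
    \<open>\<Gamma>\<close>.\<close>
  have "f i \<noteq> f j" if ij: "i < j" "j < N" for i j
  proof
    assume eq: "f i = f j"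
    have mono: "\<Gamma> ^ i \<le> \<Gamma> ^ j" "\<Gamma> \<le> \<Gamma> ^ (j - i)"
      using \<Gamma>1 ij by (auto intro: power_increasing self_le_power)
    have "(L * \<Gamma> ^ j) / (L * \<Gamma> ^ i) \<le> (30 * p) ^ 4"
    proof (rule approximation_ratio_le[of "f j"])
      show "f j \<in> lp_feasible (ring_vertices n)"
        using f(1) ij appr by (auto simp: approximates_def)
      show "?obj (L * \<Gamma> ^ i) (f j) \<le> p * ?opt (L * \<Gamma> ^ i)"
        using f(2)[of i] ij eq by simp
      show "8 / (real n)\<^sup>2 \<le> L * \<Gamma> ^ i" "L * \<Gamma> ^ j \<le> 1"
        using range[of i] range[of j] ij by auto
    qed (use n p f ij L0 mono in auto)
    moreover have "(L * \<Gamma> ^ j) / (L * \<Gamma> ^ i) = \<Gamma> ^ (j - i)"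
      using L0 \<Gamma>1 ij by (simp add: power_diff)
    ultimately show False
      using mono \<Gamma>gt by simp
  qed
  then have "inj_on f {..<N}"
    by (auto simp: inj_on_def) (metis nat_neq_iff)
  then have "N \<le> card X"
    using card_inj_on_le[of f "{..<N}" X] f(1) fin by auto
  then show ?thesis
    by (simp add: N_def)
qed

text \<open>With n = 2^k the logarithm of n / 4 is (k - 2) ln 2, and k - 2 \<ge> k / 3 from k = 3
  on. This turns the factor 2/3 into the constant 2 / (9 G).\<close>

lemma size_bound_bigomega:
  assumes "1 < p"
  shows "(\<lambda>k::nat. real_of_int (size_bound p (2 ^ k))) \<in> \<Omega>(\<lambda>k. ln (real (2 ^ k)))"
proof -
  define G where "G = ln (gamma (p * M_const))"
  have G: "0 < G"
    using gamma_M_const_bounds(1)[of p] assms by (simp add: G_def)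
  have "2 / (9 * G) * norm (ln (real (2 ^ k))) \<le> norm (real_of_int (size_bound p (2 ^ k)))"
    if k: "3 \<le> k" for k :: nat
  proof -
    have "real (2 ^ k) / 4 = 2 ^ (k - 2)"
      using k by (simp add: power_diff)
    then have "log (gamma (p * M_const)) (real (2 ^ k) / 4) = real (k - 2) * ln 2 / G"
      by (simp add: log_def G_def ln_realpow)
    then have "2 / 3 * (real (k - 2) * ln 2 / G) \<le> real_of_int (size_bound p (2 ^ k))"
      unfolding size_bound_def using le_of_int_ceiling by metis
    moreover have "2 / (9 * G) * (real k * ln 2) \<le> 2 / 3 * (real (k - 2) * ln 2 / G)"
      using G k by (simp add: field_simps of_nat_diff)
    ultimately show ?thesis
      by (simp add: ln_realpow)
  qed
  then show ?thesis
    using G by (intro landau_omega.bigI[of "2 / (9 * G)"] eventually_at_top_linorderI[of 3]) auto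
qed

theorem theorem7:
  fixes p :: real
  assumes "p > 1"
  shows "(\<forall>(k::nat) (n::nat) (X :: (nat set \<Rightarrow> real) set).
            k \<ge> 3 \<longrightarrow> n = 2 ^ k \<longrightarrow>
            approximates (ring_vertices n) (ring_edges n) p {8 / (real n)\<^sup>2 .. 1 / 2} X \<longrightarrow>
            infinite X \<or> int (card X) \<ge> size_bound p n) \<and>
         (\<lambda>k::nat. real_of_int (size_bound p (2 ^ k))) \<in> \<Omega>(\<lambda>k. ln (real (2 ^ k)))"
proof (intro conjI allI impI size_bound_bigomega assms)
  fix k n :: nat and X :: "(nat set \<Rightarrow> real) set"
  assume k: "k \<ge> 3" and n: "n = 2 ^ k"
    and X: "approximates (ring_vertices n) (ring_edges n) p {8 / (real n)\<^sup>2 .. 1 / 2} X"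
  have "(2::nat) ^ 2 \<le> 2 ^ k"
    using k by (intro power_increasing) auto
  then show "infinite X \<or> int (card X) \<ge> size_bound p n"
    using size_bound_le_card[OF assms n _ _ X] n by auto
qed

end
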